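(* Let $R$ be a ring. Then the following three statements are equivalent: (1) $R$ is a semi-regular $UJ^{\#}$ ring. (2) $R$ is an exchange $UJ^{\#}$ ring. (3) $R$ is a semi-Boolean ring.
   Context: All rings are associative with identity. $J(R)$ is the Jacobson radical and $U(R)$ the group of units of $R$. Define $J^{\#}(R)=\{z\in R : z^n\in J(R)\text{ for some } n\ge 1\}$. A ring $R$ is called a $UJ^{\#}$ ring if $U(R)=1+J^{\#}(R)$. A ring $R$ is semi-regular if $R/J(R)$ is von Neumann regular and idempotents lift modulo $J(R)$; exchange if for every $a\in R$ there is an idempotent $e\in aR$ with $1-e\in(1-a)R$; semi-Boolean if $R/J(R)$ is Boolean (every element is idempotent) and idempotents lift modulo $J(R)$. *)

theory Defs
  imports "HOL-Algebra.Algebra"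
begin

text \<open>Rings are not assumed commutative, so the library's \<^locale>\<open>maximalideal\<close>, which
  is about two-sided ideals, cannot be used to define the Jacobson radical.\<close>

locale left_ideal = additive_subgroup I R + ring R for I and R (structure) +
  assumes l_closed: "\<lbrakk>a \<in> I; x \<in> carrier R\<rbrakk> \<Longrightarrow> x \<otimes> a \<in> I"

locale maximal_left_ideal = left_ideal +
  assumes notcarr: "carrier R \<noteq> I"
    and maximal: "\<lbrakk>left_ideal K R; I \<subseteq> K; K \<subseteq> carrier R\<rbrakk> \<Longrightarrow> K = I \<or> K = carrier R"

text \<open>The intersection with \<^term>\<open>carrier R\<close> matters only for the zero ring, which has no
  maximal left ideal and is its own radical.\<close>

definition jacobson_radical :: "('a, 'b) ring_scheme \<Rightarrow> 'a set" where
  "jacobson_radical R = carrier R \<inter> \<Inter> {I. maximal_left_ideal I R}"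

definition J_sharp :: "('a, 'b) ring_scheme \<Rightarrow> 'a set" where
  "J_sharp R = {z \<in> carrier R. \<exists>n::nat. n \<ge> 1 \<and> z [^]\<^bsub>R\<^esub> n \<in> jacobson_radical R}"

definition UJ_sharp_ring :: "('a, 'b) ring_scheme \<Rightarrow> bool" where
  "UJ_sharp_ring R \<longleftrightarrow> Units R = (\<lambda>z. \<one>\<^bsub>R\<^esub> \<oplus>\<^bsub>R\<^esub> z) ` J_sharp R"

definition idempotents :: "('a, 'b) ring_scheme \<Rightarrow> 'a set" where
  "idempotents R = {e \<in> carrier R. e \<otimes>\<^bsub>R\<^esub> e = e}"

definition idempotents_lift :: "('a, 'b) ring_scheme \<Rightarrow> 'a set \<Rightarrow> bool" where
  "idempotents_lift R I \<longleftrightarrow>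
     (\<forall>x \<in> idempotents (R Quot I). \<exists>e \<in> idempotents R. I +>\<^bsub>R\<^esub> e = x)"

definition von_neumann_regular_ring :: "('a, 'b) ring_scheme \<Rightarrow> bool" where
  "von_neumann_regular_ring R \<longleftrightarrow>
     (\<forall>a \<in> carrier R. \<exists>x \<in> carrier R. a = a \<otimes>\<^bsub>R\<^esub> x \<otimes>\<^bsub>R\<^esub> a)"

definition boolean_ring :: "('a, 'b) ring_scheme \<Rightarrow> bool" where
  "boolean_ring R \<longleftrightarrow> (\<forall>a \<in> carrier R. a \<in> idempotents R)"

definition semi_regular_ring :: "('a, 'b) ring_scheme \<Rightarrow> bool" where
  "semi_regular_ring R \<longleftrightarrow>
     von_neumann_regular_ring (R Quot jacobson_radical R) \<and>
     idempotents_lift R (jacobson_radical R)"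

text \<open>\<^term>\<open>a <#\<^bsub>R\<^esub> carrier R\<close> is the principal right ideal generated by \<^term>\<open>a\<close>.\<close>

definition exchange_ring :: "('a, 'b) ring_scheme \<Rightarrow> bool" where
  "exchange_ring R \<longleftrightarrow>
     (\<forall>a \<in> carrier R. \<exists>e \<in> idempotents R.
        e \<in> a <#\<^bsub>R\<^esub> carrier R \<and>
        \<one>\<^bsub>R\<^esub> \<ominus>\<^bsub>R\<^esub> e \<in> (\<one>\<^bsub>R\<^esub> \<ominus>\<^bsub>R\<^esub> a) <#\<^bsub>R\<^esub> carrier R)"

definition semi_boolean_ring :: "('a, 'b) ring_scheme \<Rightarrow> bool" where
  "semi_boolean_ring R \<longleftrightarrow>
     boolean_ring (R Quot jacobson_radical R) \<and>
     idempotents_lift R (jacobson_radical R)"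

end

theory Submission
  imports Defs
begin

text \<open>Let \<open>S = R/J(R)\<close>. If \<open>R\<close> is semi-regular or exchange, every nonzero \<open>x \<in> S\<close> has a
  nonzero idempotent multiple \<open>xy\<close>; if \<open>R\<close> is a \<open>UJ\<^sup>#\<close> ring, every unit of \<open>S\<close> is unipotent.
  These two properties force \<open>S\<close> to be Boolean. First, \<open>S\<close> is reduced: a nonzero \<open>x\<close> with
  \<open>x\<^sup>2 = 0\<close> would yield \<open>2 \<times> 2\<close> matrix units \<open>x\<close>, \<open>y\<close>, \<open>xy\<close>, \<open>yx\<close>, and \<open>(1 + x)(1 + y)\<close>
  would be a unit that is not unipotent. Hence idempotents of \<open>S\<close> are central and \<open>1\<close> is its
  only unit. If \<open>a\<^sup>2 - a \<noteq> 0\<close>, take a nonzero idempotent \<open>e = (a\<^sup>2 - a)y\<close>; then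
  \<open>ea + (1 - e)\<close> is a unit, so \<open>ea = e\<close> and \<open>e = e(a\<^sup>2 - a)y = 0\<close>, a contradiction.

  Conversely, if \<open>S\<close> is Boolean, units of \<open>R\<close> lie in \<open>1 + J(R)\<close>, and the exchange property
  follows by lifting \<open>a + J(R)\<close> to an idempotent and correcting it twice.\<close>

definition nonzero_idempotent_multiples :: "('a, 'b) ring_scheme \<Rightarrow> bool" where
  "nonzero_idempotent_multiples R \<longleftrightarrow>
     (\<forall>x \<in> carrier R - {\<zero>\<^bsub>R\<^esub>}. \<exists>y \<in> carrier R.
        x \<otimes>\<^bsub>R\<^esub> y \<in> idempotents R - {\<zero>\<^bsub>R\<^esub>})"

definition unipotent_units :: "('a, 'b) ring_scheme \<Rightarrow> bool" where
  "unipotent_units R \<longleftrightarrow>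
     (\<forall>u \<in> Units R. \<exists>n::nat. (u \<ominus>\<^bsub>R\<^esub> \<one>\<^bsub>R\<^esub>) [^]\<^bsub>R\<^esub> n = \<zero>\<^bsub>R\<^esub>)"

context ring
begin

section \<open>Left ideals and the existence of maximal ones\<close>

lemma left_idealI:
  assumes "I \<subseteq> carrier R" "\<zero> \<in> I"
    and "\<And>a b. \<lbrakk>a \<in> I; b \<in> I\<rbrakk> \<Longrightarrow> a \<oplus> b \<in> I"
    and l: "\<And>a x. \<lbrakk>a \<in> I; x \<in> carrier R\<rbrakk> \<Longrightarrow> x \<otimes> a \<in> I"
  shows "left_ideal I R"
proof -
  \<comment> \<open>Negation is multiplication by \<open>\<ominus> \<one>\<close>.\<close>
  have "\<ominus> x \<in> I" if "x \<in> I" for x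
    using l[OF that, of "\<ominus> \<one>"] that assms(1) by (auto simp: l_minus)
  then have "subgroup I (add_monoid R)"
    using assms by (intro add.subgroupI) (auto simp: a_inv_def)
  then show ?thesis
    using l by (intro left_ideal.intro additive_subgroup.intro left_ideal_axioms.intro ring_axioms)
qed

lemma left_idealD:
  assumes "left_ideal I R"
  shows "I \<subseteq> carrier R" "\<zero> \<in> I" "\<And>a b. \<lbrakk>a \<in> I; b \<in> I\<rbrakk> \<Longrightarrow> a \<oplus> b \<in> I"
    "\<And>a x. \<lbrakk>a \<in> I; x \<in> carrier R\<rbrakk> \<Longrightarrow> x \<otimes> a \<in> I"
    "\<And>a. a \<in> I \<Longrightarrow> \<ominus> a \<in> I"
proof -
  interpret left_ideal I R by fact
  show "I \<subseteq> carrier R" "\<zero> \<in> I" "\<And>a b. \<lbrakk>a \<in> I; b \<in> I\<rbrakk> \<Longrightarrow> a \<oplus> b \<in> I"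
    "\<And>a x. \<lbrakk>a \<in> I; x \<in> carrier R\<rbrakk> \<Longrightarrow> x \<otimes> a \<in> I"
    "\<And>a. a \<in> I \<Longrightarrow> \<ominus> a \<in> I"
    by (auto simp: a_subset l_closed a_inv_closed)
qed

lemma left_ideal_eq_carrier:
  assumes "left_ideal I R" "\<one> \<in> I"
  shows "I = carrier R"
  using left_idealD(1)[OF assms(1)] left_idealD(4)[OF assms] by force

lemma left_ideal_principal:
  assumes "a \<in> carrier R"
  shows "left_ideal ((\<lambda>r. r \<otimes> a) ` carrier R) R"
proof (rule left_idealI)
  show "\<zero> \<in> (\<lambda>r. r \<otimes> a) ` carrier R"
    using assms by (auto intro: image_eqI[of _ _ \<zero>])
  show "b \<oplus> c \<in> (\<lambda>r. r \<otimes> a) ` carrier R"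
    if "b \<in> (\<lambda>r. r \<otimes> a) ` carrier R" "c \<in> (\<lambda>r. r \<otimes> a) ` carrier R" for b c
    using that assms by (auto simp flip: l_distr)
qed (use assms in \<open>auto simp flip: m_assoc\<close>)

text \<open>With \<open>I\<close> maximal and \<open>a\<close> outside it, this is the larger left
  ideal on which maximality is tested.\<close>

lemma left_ideal_sum_principal:
  assumes "left_ideal I R" "a \<in> carrier R"
  shows "left_ideal {m \<oplus> r \<otimes> a | m r. m \<in> I \<and> r \<in> carrier R} R"
proof (rule left_idealI)
  note I = left_idealD[OF assms(1)]
  let ?K = "{m \<oplus> r \<otimes> a | m r. m \<in> I \<and> r \<in> carrier R}"
  show "?K \<subseteq> carrier R" using I(1) assms(2) by auto
  have "\<zero> = \<zero> \<oplus> \<zero> \<otimes> a" using assms(2) by simp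
  then show "\<zero> \<in> ?K" using I(2) by blast
  show "b \<oplus> c \<in> ?K" if bc: "b \<in> ?K" "c \<in> ?K" for b c
  proof -
    obtain m r n s where *: "b = m \<oplus> r \<otimes> a" "c = n \<oplus> s \<otimes> a" "m \<in> I" "n \<in> I"
      "r \<in> carrier R" "s \<in> carrier R" using bc by blast
    then have "m \<in> carrier R" "n \<in> carrier R" using I(1) by auto
    then have "b \<oplus> c = (m \<oplus> n) \<oplus> (r \<oplus> s) \<otimes> a"
      using * assms(2) by (simp add: l_distr a_ac)
    then show ?thesis using * I(3) by blast
  qed
  show "x \<otimes> b \<in> ?K" if b: "b \<in> ?K" and x: "x \<in> carrier R" for b x
  proof -
    obtain m r where *: "b = m \<oplus> r \<otimes> a" "m \<in> I" "r \<in> carrier R" using b by blast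
    then have "m \<in> carrier R" using I(1) by auto
    then have "x \<otimes> b = x \<otimes> m \<oplus> (x \<otimes> r) \<otimes> a"
      using * x assms(2) by (simp add: r_distr m_assoc)
    then show ?thesis using * x I(4) by blast
  qed
qed

text \<open>Zorn's lemma on the left ideals that contain \<open>I\<close> and avoid
  \<open>\<one>\<close>. Properness is tested by the single element \<open>\<one>\<close>, so it
  survives unions of chains.\<close>

lemma exists_maximal_left_ideal:
  assumes "left_ideal I R" "\<one> \<notin> I"
  shows "\<exists>M. maximal_left_ideal M R \<and> I \<subseteq> M"
proof -
  define A where "A = {K. left_ideal K R \<and> I \<subseteq> K \<and> \<one> \<notin> K}"
  have "\<Union>C \<in> A" if C: "C \<noteq> {}" "subset.chain A C" for C
  proof -
    have CA: "C \<subseteq> A" and tot: "\<And>K L. \<lbrakk>K \<in> C; L \<in> C\<rbrakk> \<Longrightarrow> K \<subseteq> L \<or> L \<subseteq> K"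
      using C(2) by (auto simp: subset_chain_def)
    then have li: "\<And>K. K \<in> C \<Longrightarrow> left_ideal K R" by (auto simp: A_def)
    have "left_ideal (\<Union>C) R"
    proof (rule left_idealI)
      show "\<Union>C \<subseteq> carrier R" using left_idealD(1)[OF li] by blast
      show "\<zero> \<in> \<Union>C" using left_idealD(2)[OF li] C(1) by blast
      show "a \<oplus> b \<in> \<Union>C" if "a \<in> \<Union>C" "b \<in> \<Union>C" for a b
        using that tot left_idealD(3)[OF li] by (meson UnionE UnionI subsetD)
      show "x \<otimes> a \<in> \<Union>C" if "a \<in> \<Union>C" "x \<in> carrier R" for a x
        using that left_idealD(4)[OF li] by blast
    qed
    then show ?thesis using C(1) CA by (auto simp: A_def)
  qed
  moreover have "A \<noteq> {}" using assms by (auto simp: A_def)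
  ultimately obtain M where M: "M \<in> A" "\<forall>K\<in>A. M \<subseteq> K \<longrightarrow> K = M"
    using subset_Zorn_nonempty[of A] by auto
  have "maximal_left_ideal M R"
  proof (intro maximal_left_ideal.intro maximal_left_ideal_axioms.intro)
    show "left_ideal M R" "carrier R \<noteq> M" using M(1) by (auto simp: A_def)
    show "K = M \<or> K = carrier R" if "left_ideal K R" "M \<subseteq> K" for K
      using that M left_ideal_eq_carrier[of K] by (auto simp: A_def)
  qed
  then show ?thesis using M(1) by (auto simp: A_def)
qed

section \<open>The Jacobson radical described by units, from either side\<close>

lemma left_ideal_jacobson_radical: "left_ideal (jacobson_radical R) R"
proof -
  have "left_ideal I R" if "maximal_left_ideal I R" for I
    using that by (rule maximal_left_ideal.axioms)
  then show ?thesis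
    by (intro left_idealI) (auto simp: jacobson_radical_def dest: left_idealD)
qed

text \<open>A left inverse \<open>u\<close> and a right inverse \<open>w\<close> of the same
  \<open>v\<close> coincide.\<close>

lemma Units_of_left_inverses:
  assumes "v \<in> carrier R" "w \<in> carrier R" "u \<in> carrier R" "u \<otimes> v = \<one>" "v \<otimes> w = \<one>"
  shows "v \<in> Units R" "w \<in> Units R" "u \<in> Units R"
proof -
  have "u = w" using assms by (metis inv_unique)
  then show "v \<in> Units R" "w \<in> Units R" "u \<in> Units R" using assms by (auto simp: Units_def)
qed

text \<open>Jacobson's lemma; it lets left-handed and right-handed descriptions of the radical be
  exchanged.\<close>

lemma Units_one_minus_swap:
  assumes ab: "a \<in> carrier R" "b \<in> carrier R" and u: "\<one> \<ominus> a \<otimes> b \<in> Units R"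
  shows "\<one> \<ominus> b \<otimes> a \<in> Units R"
proof -
  define w where "w = inv (\<one> \<ominus> a \<otimes> b)"
  have w: "w \<in> carrier R" using u by (simp add: w_def)
  have "(\<one> \<ominus> a \<otimes> b) \<otimes> w = \<one>" "w \<otimes> (\<one> \<ominus> a \<otimes> b) = \<one>"
    using u by (simp_all add: w_def)
  then have 1: "w \<ominus> a \<otimes> (b \<otimes> w) = \<one>" and 2: "w \<ominus> w \<otimes> (a \<otimes> b) = \<one>"
    using ab w by (simp_all add: minus_eq l_distr r_distr l_minus r_minus m_assoc)
  \<comment> \<open>The geometric series for \<open>\<one> \<ominus> b \<otimes> a\<close> is
    formally \<open>\<one>\<close> plus \<open>b\<close> times the series for
    \<open>\<one> \<ominus> a \<otimes> b\<close> times \<open>a\<close>, which suggests this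
    inverse.\<close>
  let ?v = "\<one> \<oplus> b \<otimes> w \<otimes> a"
  have "(\<one> \<ominus> b \<otimes> a) \<otimes> ?v = \<one> \<ominus> b \<otimes> a \<oplus> b \<otimes> (w \<ominus> a \<otimes> (b \<otimes> w)) \<otimes> a"
    using ab w by (simp add: minus_eq l_distr r_distr l_minus r_minus m_assoc minus_add a_ac)
  then have l: "(\<one> \<ominus> b \<otimes> a) \<otimes> ?v = \<one>"
    unfolding 1 using ab by (simp add: minus_eq a_ac r_neg l_neg)
  have "?v \<otimes> (\<one> \<ominus> b \<otimes> a) = \<one> \<ominus> b \<otimes> a \<oplus> b \<otimes> (w \<ominus> w \<otimes> (a \<otimes> b)) \<otimes> a"
    using ab w by (simp add: minus_eq l_distr r_distr l_minus r_minus m_assoc minus_add a_ac)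
  then have r: "?v \<otimes> (\<one> \<ominus> b \<otimes> a) = \<one>"
    unfolding 2 using ab by (simp add: minus_eq a_ac r_neg l_neg)
  show ?thesis using l r ab w by (auto simp: Units_def intro!: bexI[of _ ?v])
qed

text \<open>Otherwise the left ideal generated by \<open>\<one> \<ominus> j\<close> lies in a
  maximal one, which also contains \<open>j\<close> and hence \<open>\<one>\<close>.\<close>

lemma jacobson_radical_left_inverse:
  assumes j: "j \<in> jacobson_radical R"
  shows "\<exists>v\<in>carrier R. v \<otimes> (\<one> \<ominus> j) = \<one>"
proof (rule ccontr)
  assume no: "\<not> ?thesis"
  have jc: "j \<in> carrier R" using j by (simp add: jacobson_radical_def)
  let ?I = "(\<lambda>r. r \<otimes> (\<one> \<ominus> j)) ` carrier R"
  have "left_ideal ?I R" using jc by (intro left_ideal_principal) auto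
  moreover have "\<one> \<notin> ?I" using no by force
  ultimately obtain M where M: "maximal_left_ideal M R" "?I \<subseteq> M"
    using exists_maximal_left_ideal by blast
  note lM = maximal_left_ideal.axioms(1)[OF M(1)]
  have "\<one> \<otimes> (\<one> \<ominus> j) \<in> M" using M(2) by auto
  then have "(\<one> \<ominus> j) \<oplus> j \<in> M"
    using j M(1) jc by (intro left_idealD(3)[OF lM]) (auto simp: jacobson_radical_def)
  moreover have "(\<one> \<ominus> j) \<oplus> j = \<one>" using jc by (simp add: minus_eq a_assoc l_neg)
  ultimately show False
    using left_ideal_eq_carrier[OF lM] maximal_left_ideal.notcarr[OF M(1)] by auto
qed

text \<open>The left inverse \<open>v\<close> equals \<open>\<one> \<oplus> v \<otimes> j\<close>,
  again \<open>\<one>\<close> minus a radical element, so it has a left inverse of its own besides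
  its right inverse \<open>\<one> \<ominus> j\<close>.\<close>

lemma jacobson_radical_one_minus_Units:
  assumes j: "j \<in> jacobson_radical R"
  shows "\<one> \<ominus> j \<in> Units R"
proof -
  note J = left_idealD[OF left_ideal_jacobson_radical]
  have jc: "j \<in> carrier R" using j by (simp add: jacobson_radical_def)
  obtain v where v: "v \<in> carrier R" "v \<otimes> (\<one> \<ominus> j) = \<one>"
    using jacobson_radical_left_inverse[OF j] by blast
  then have "v \<ominus> v \<otimes> j = \<one>"
    using jc by (simp add: minus_eq r_distr r_minus)
  then have "v = \<one> \<ominus> (\<ominus> (v \<otimes> j))"
    using v jc by (metis add.inv_solve_right m_closed minus_eq minus_minus one_closed)
  moreover have "\<ominus> (v \<otimes> j) \<in> jacobson_radical R" using J(4,5) j v by blast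
  ultimately obtain u where "u \<in> carrier R" "u \<otimes> v = \<one>"
    using jacobson_radical_left_inverse by metis
  then show ?thesis using Units_of_left_inverses(2)[of v "\<one> \<ominus> j" u] v jc by auto
qed

text \<open>If a maximal left ideal \<open>M\<close> misses \<open>x\<close>, then
  \<open>\<one> = m \<oplus> r \<otimes> x\<close> with \<open>m\<close> in \<open>M\<close>, and
  \<open>m = \<one> \<ominus> r \<otimes> x\<close> would be a unit in a proper left ideal.\<close>

lemma jacobson_radicalI:
  assumes x: "x \<in> carrier R" and inv: "\<And>r. r \<in> carrier R \<Longrightarrow> \<one> \<ominus> r \<otimes> x \<in> Units R"
  shows "x \<in> jacobson_radical R"
proof (rule ccontr)
  assume "x \<notin> jacobson_radical R"
  then obtain M where M: "maximal_left_ideal M R" "x \<notin> M"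
    using x by (auto simp: jacobson_radical_def)
  note lM = maximal_left_ideal.axioms(1)[OF M(1)]
  note MD = left_idealD[OF lM]
  let ?K = "{m \<oplus> r \<otimes> x | m r. m \<in> M \<and> r \<in> carrier R}"
  have K: "left_ideal ?K R" by (rule left_ideal_sum_principal[OF lM x])
  have "M \<subseteq> ?K"
  proof
    fix m assume "m \<in> M"
    moreover from this have "m = m \<oplus> \<zero> \<otimes> x" using MD(1) x by auto
    ultimately show "m \<in> ?K" by blast
  qed
  moreover have "x = \<zero> \<oplus> \<one> \<otimes> x" using x by simp
  then have "x \<in> ?K" using MD(2) one_closed by blast
  ultimately have "?K = carrier R"
    using maximal_left_ideal.maximal[OF M(1) K] left_idealD(1)[OF K] M(2) by blast
  then obtain m r where *: "\<one> = m \<oplus> r \<otimes> x" "m \<in> M" "r \<in> carrier R"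
    using one_closed by blast
  then have "m = \<one> \<ominus> r \<otimes> x"
    using MD(1) x by (auto simp: minus_eq a_assoc r_neg)
  then have "m \<in> Units R" using inv *(3) by auto
  then have "\<one> \<in> M" using MD(4)[OF *(2), of "inv m"] by auto
  then show False
    using left_ideal_eq_carrier[OF lM] maximal_left_ideal.notcarr[OF M(1)] by auto
qed

lemma ideal_jacobson_radical: "ideal (jacobson_radical R) R"
proof (rule idealI)
  note J = left_idealD[OF left_ideal_jacobson_radical]
  show "ring R" by (rule ring_axioms)
  show "subgroup (jacobson_radical R) (add_monoid R)"
    using left_ideal_jacobson_radical
    by (simp add: left_ideal_def additive_subgroup_def)
  show "x \<otimes> a \<in> jacobson_radical R" if "a \<in> jacobson_radical R" "x \<in> carrier R" for a x
    using that by (rule J(4))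
  show "a \<otimes> x \<in> jacobson_radical R" if "a \<in> jacobson_radical R" "x \<in> carrier R" for a x
  proof (rule jacobson_radicalI)
    have a: "a \<in> carrier R" using that J(1) by blast
    then show "a \<otimes> x \<in> carrier R" using that by simp
    fix r assume r: "r \<in> carrier R"
    \<comment> \<open>Left multiples of \<open>a\<close> are already known to be radical; the swap
      then carries \<open>x\<close> to the right of \<open>a\<close>.\<close>
    have "\<one> \<ominus> x \<otimes> (r \<otimes> a) \<in> Units R"
      using that r J(4) by (intro jacobson_radical_one_minus_Units) blast
    then have "\<one> \<ominus> (r \<otimes> a) \<otimes> x \<in> Units R"
      using that r a by (intro Units_one_minus_swap[of x]) auto
    then show "\<one> \<ominus> r \<otimes> (a \<otimes> x) \<in> Units R" using that r a by (simp add: m_assoc)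
  qed
qed

text \<open>A right-handed criterion, suited to the right ideals in the exchange property. The right
  inverse \<open>v\<close> of \<open>\<one> \<ominus> x \<otimes> r\<close> is itself
  \<open>\<one>\<close> minus a right multiple of \<open>x\<close>, so it is right invertible too
  and both are units.\<close>

lemma jacobson_radicalI_right_inverse:
  assumes x: "x \<in> carrier R"
    and inv: "\<And>r. r \<in> carrier R \<Longrightarrow> \<exists>v\<in>carrier R. (\<one> \<ominus> x \<otimes> r) \<otimes> v = \<one>"
  shows "x \<in> jacobson_radical R"
proof (rule jacobson_radicalI[OF x])
  fix r assume r: "r \<in> carrier R"
  obtain v where v: "v \<in> carrier R" "(\<one> \<ominus> x \<otimes> r) \<otimes> v = \<one>" using inv[OF r] by blast
  then have "v \<ominus> x \<otimes> r \<otimes> v = \<one>"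
    using r x by (simp add: minus_eq l_distr l_minus)
  then have "v = \<one> \<ominus> x \<otimes> (\<ominus> (r \<otimes> v))"
    using v x r by (simp add: minus_eq r_minus m_assoc)
      (metis add.inv_solve_right m_closed minus_eq one_closed)
  then obtain w where "w \<in> carrier R" "v \<otimes> w = \<one>"
    using inv[of "\<ominus> (r \<otimes> v)"] v r by auto
  then have "\<one> \<ominus> x \<otimes> r \<in> Units R"
    using Units_of_left_inverses(3)[of v w "\<one> \<ominus> x \<otimes> r"] v x r by auto
  then show "\<one> \<ominus> r \<otimes> x \<in> Units R" using Units_one_minus_swap x r by blast
qed

section \<open>Unipotent units exclude elements of square zero\<close>

lemma one_plus_square_zero_Units:
  assumes "x \<in> carrier R" "x \<otimes> x = \<zero>"
  shows "\<one> \<oplus> x \<in> Units R"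
proof -
  have "(\<one> \<oplus> x) \<otimes> (\<one> \<ominus> x) = \<one>" "(\<one> \<ominus> x) \<otimes> (\<one> \<oplus> x) = \<one>"
    using assms by (simp_all add: minus_eq l_distr r_distr l_minus r_minus a_assoc r_neg l_neg)
  then show ?thesis using assms(1) by (auto simp: Units_def intro!: bexI[of _ "\<one> \<ominus> x"])
qed

text \<open>The elements \<open>x\<close>, \<open>y\<close>, \<open>x \<otimes> y\<close>,
  \<open>y \<otimes> x\<close> multiply like the matrix units e12, e21, e11, e22. In these terms
  \<open>s\<close> is the Fibonacci matrix with rows (1, 1) and (1, 0); its square is
  \<open>s\<close> plus the corner identity, so \<open>s\<close> can be nilpotent only by being
  zero.\<close>

lemma square_zero_matrix_units_trivial:
  assumes uni: "unipotent_units R"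
    and c: "x \<in> carrier R" "y \<in> carrier R"
    and xx: "x \<otimes> x = \<zero>" and yy: "y \<otimes> y = \<zero>"
    and xyx: "x \<otimes> (y \<otimes> x) = x" and yxy: "y \<otimes> (x \<otimes> y) = y"
  shows "x \<otimes> y = \<zero>"
proof -
  define s where "s = x \<otimes> y \<oplus> x \<oplus> y"
  have s: "s \<in> carrier R" using c by (simp add: s_def)
  \<comment> \<open>Products are normalized to the right, so each relation is also stated with an
    arbitrary factor \<open>z\<close> behind it.\<close>
  have tails: "x \<otimes> (x \<otimes> z) = \<zero>" "y \<otimes> (y \<otimes> z) = \<zero>"
    "x \<otimes> (y \<otimes> (x \<otimes> z)) = x \<otimes> z" "y \<otimes> (x \<otimes> (y \<otimes> z)) = y \<otimes> z" if "z \<in> carrier R" for z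
  proof -
    show "x \<otimes> (x \<otimes> z) = \<zero>" "y \<otimes> (y \<otimes> z) = \<zero>"
      using that c xx yy by (simp_all flip: m_assoc)
    have "x \<otimes> (y \<otimes> x) \<otimes> z = x \<otimes> z" "y \<otimes> (x \<otimes> y) \<otimes> z = y \<otimes> z"
      by (simp_all only: xyx yxy)
    then show "x \<otimes> (y \<otimes> (x \<otimes> z)) = x \<otimes> z" "y \<otimes> (x \<otimes> (y \<otimes> z)) = y \<otimes> z"
      using that c by (simp_all add: m_assoc)
  qed
  note expand = l_distr r_distr m_assoc xx yy xyx yxy tails a_ac
  have "(\<one> \<oplus> x) \<otimes> (\<one> \<oplus> y) \<ominus> \<one> = s \<oplus> (\<one> \<ominus> \<one>)"
    using c by (simp add: s_def minus_eq l_distr r_distr a_ac)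
  then have "(\<one> \<oplus> x) \<otimes> (\<one> \<oplus> y) \<ominus> \<one> = s"
    using s by (simp add: minus_eq r_neg)
  moreover have "(\<one> \<oplus> x) \<otimes> (\<one> \<oplus> y) \<in> Units R"
    using c xx yy by (simp add: one_plus_square_zero_Units)
  ultimately obtain n :: nat where "s [^] n = \<zero>"
    using uni unfolding unipotent_units_def by metis
  \<comment> \<open>Since \<open>n\<close> may be \<open>0\<close>, the descent to \<open>s\<close>
    starts from the positive exponent \<open>Suc n\<close>.\<close>
  then have nil: "s [^] Suc n = \<zero>" using s by simp
  have ss: "s \<otimes> s = s \<oplus> (x \<otimes> y \<oplus> y \<otimes> x)"
    using c by (simp add: s_def expand)
  moreover have "(x \<otimes> y \<oplus> y \<otimes> x) \<otimes> s = s"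
    using c by (simp add: s_def expand)
  ultimately have "s \<otimes> s \<otimes> s = s \<otimes> s \<oplus> s"
    using c s by (metis l_distr add.m_closed m_closed)
  then have cube: "s = s \<otimes> s \<otimes> (s \<ominus> \<one>)"
    using s by (simp add: minus_eq r_distr r_minus a_ac r_neg r_neg1 r_neg2 m_assoc)
  \<comment> \<open>By \<open>cube\<close> each positive power of \<open>s\<close> is a multiple of
    the next one, so vanishing passes down to \<open>s\<close> itself.\<close>
  have "s [^] Suc m = s [^] Suc (Suc m) \<otimes> (s \<ominus> \<one>)" for m :: nat
  proof -
    have "s [^] Suc m = s [^] m \<otimes> (s \<otimes> s \<otimes> (s \<ominus> \<one>))" using cube by simp
    also have "\<dots> = s [^] Suc (Suc m) \<otimes> (s \<ominus> \<one>)" using s by (simp add: m_assoc)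
    finally show ?thesis .
  qed
  then have step: "s [^] Suc m = \<zero>" if "s [^] Suc (Suc m) = \<zero>" for m :: nat
    using that s by (metis l_null minus_closed one_closed)
  have "s [^] Suc m = \<zero> \<Longrightarrow> s = \<zero>" for m :: nat
  proof (induction m)
    case 0
    then show ?case using s by simp
  next
    case (Suc m)
    then show ?case using step by blast
  qed
  then have "s = \<zero>" using nil by blast
  \<comment> \<open>Multiplying by \<open>x\<close> kills every term of \<open>s\<close> except
    \<open>y\<close>.\<close>
  then have "x \<otimes> s = \<zero>" using c by simp
  then show ?thesis using c by (simp add: s_def expand)
qed

lemma unipotent_units_square_zero:
  assumes uni: "unipotent_units R" and idem: "nonzero_idempotent_multiples R"
    and x: "x \<in> carrier R" "x \<otimes> x = \<zero>"
  shows "x = \<zero>"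
proof (rule ccontr)
  assume "x \<noteq> \<zero>"
  then obtain y where y: "y \<in> carrier R" "x \<otimes> y \<in> idempotents R" "x \<otimes> y \<noteq> \<zero>"
    using idem x unfolding nonzero_idempotent_multiples_def by blast
  define e where "e = x \<otimes> y"
  have c: "x \<in> carrier R" "y \<in> carrier R" "e \<in> carrier R" using x y by (auto simp: e_def)
  have ee: "e \<otimes> e = e" using y by (simp add: e_def idempotents_def)
  have xe: "x \<otimes> e = \<zero>" using x y by (simp add: e_def flip: m_assoc)
  have ee': "e \<otimes> (e \<otimes> z) = e \<otimes> z" "x \<otimes> (e \<otimes> z) = \<zero>" "x \<otimes> (x \<otimes> z) = \<zero>"
    "x \<otimes> (y \<otimes> z) = e \<otimes> z" if "z \<in> carrier R" for z
    using that c ee xe x by (simp_all add: e_def flip: m_assoc)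
  \<comment> \<open>The relations \<open>y \<otimes> y = \<zero>\<close> and
    \<open>x \<otimes> (y \<otimes> x) = x\<close> may fail. Since
    \<open>x \<otimes> e = \<zero>\<close>, cutting down by \<open>e\<close> and
    \<open>\<one> \<ominus> e\<close> restores them while keeping the product
    \<open>e\<close>.\<close>
  define x' y' where "x' = e \<otimes> x" and "y' = (\<one> \<ominus> e) \<otimes> (y \<otimes> e)"
  have c': "x' \<in> carrier R" "y' \<in> carrier R" using c by (auto simp: x'_def y'_def)
  note expand = minus_eq l_distr r_distr l_minus r_minus m_assoc ee xe ee' r_neg l_neg
  have xy': "x' \<otimes> y' = e" and ey': "e \<otimes> y' = \<zero>" and ye': "y' \<otimes> e = y'"
    and ex': "e \<otimes> x' = x'"
    using c by (simp_all add: x'_def y'_def expand)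
  have "x' \<otimes> x' = \<zero>"
    using c by (simp add: x'_def m_assoc ee')
  moreover have "y' \<otimes> y' = \<zero>"
    using ye' ey' c c' by (metis m_assoc r_null)
  moreover have "x' \<otimes> (y' \<otimes> x') = x'"
    using c' c xy' ex' by (metis m_assoc)
  moreover have "y' \<otimes> (x' \<otimes> y') = y'"
    using xy' ye' by simp
  ultimately have "x' \<otimes> y' = \<zero>"
    using square_zero_matrix_units_trivial[OF uni c'] by blast
  then show False using xy' y(3) by (simp add: e_def)
qed

section \<open>Reduced rings and the Boolean property\<close>

text \<open>The square of \<open>z [^] Suc m\<close> contains the factor
  \<open>z [^] Suc (Suc m)\<close>, so the vanishing exponent can be lowered one by one.\<close>

lemma reduced_nilpotent_zero:
  assumes red: "\<And>x. \<lbrakk>x \<in> carrier R; x \<otimes> x = \<zero>\<rbrakk> \<Longrightarrow> x = \<zero>"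
    and z: "z \<in> carrier R" "z [^] (n::nat) = \<zero>"
  shows "z = \<zero>"
proof -
  have "z [^] Suc m = \<zero> \<Longrightarrow> z = \<zero>" for m :: nat
  proof (induction m)
    case 0
    then show ?case using z by simp
  next
    case (Suc m)
    have "z [^] Suc m \<otimes> z [^] Suc m = z [^] Suc (Suc m) \<otimes> z [^] m"
      using z(1) by (simp only: nat_pow_mult) simp
    then have "z [^] Suc m \<otimes> z [^] Suc m = \<zero>" using Suc.prems z(1) by simp
    then have "z [^] Suc m = \<zero>" using red[of "z [^] Suc m"] z(1) by blast
    then show ?case by (rule Suc.IH)
  qed
  moreover have "z [^] Suc n = \<zero>" using z by simp
  ultimately show ?thesis by blast
qed

text \<open>Both \<open>e \<otimes> a \<otimes> (\<one> \<ominus> e)\<close> and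
  \<open>(\<one> \<ominus> e) \<otimes> a \<otimes> e\<close> have square zero, so
  \<open>e \<otimes> a\<close> and \<open>a \<otimes> e\<close> both equal
  \<open>e \<otimes> a \<otimes> e\<close>.\<close>

lemma reduced_idempotent_central:
  assumes red: "\<And>x. \<lbrakk>x \<in> carrier R; x \<otimes> x = \<zero>\<rbrakk> \<Longrightarrow> x = \<zero>"
    and e: "e \<in> idempotents R" and a: "a \<in> carrier R"
  shows "a \<otimes> e = e \<otimes> a"
proof -
  have ec: "e \<in> carrier R" and ee: "e \<otimes> e = e" using e by (auto simp: idempotents_def)
  have ee': "e \<otimes> (e \<otimes> z) = e \<otimes> z" if "z \<in> carrier R" for z
    using that ec ee by (simp flip: m_assoc)
  note expand = minus_eq l_distr r_distr l_minus r_minus m_assoc ee ee' r_neg l_neg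
  have "e \<otimes> a \<ominus> e \<otimes> (a \<otimes> e) = \<zero>"
    by (rule red) (use ec a in \<open>simp_all add: expand\<close>)
  moreover have "a \<otimes> e \<ominus> e \<otimes> (a \<otimes> e) = \<zero>"
    by (rule red) (use ec a in \<open>simp_all add: expand\<close>)
  ultimately show ?thesis using ec a by (metis m_closed r_right_minus_eq)
qed

lemma boolean_ring_if_unipotent_units:
  assumes uni: "unipotent_units R" and idem: "nonzero_idempotent_multiples R"
  shows "boolean_ring R"
  unfolding boolean_ring_def
proof (rule ballI, rule ccontr)
  note red = unipotent_units_square_zero[OF uni idem]
  have central: "b \<otimes> e = e \<otimes> b" if "e \<in> idempotents R" "b \<in> carrier R" for b e
    using reduced_idempotent_central red that by blast
  fix a assume a: "a \<in> carrier R" "a \<notin> idempotents R"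
  define d where "d = a \<otimes> (a \<ominus> \<one>)"
  have d: "d \<in> carrier R" using a by (simp add: d_def)
  have "d = a \<otimes> a \<ominus> a" using a by (simp add: d_def minus_eq r_distr r_minus)
  then have "d \<noteq> \<zero>" using a by (simp add: idempotents_def)
  then obtain y where y: "y \<in> carrier R" "d \<otimes> y \<in> idempotents R" "d \<otimes> y \<noteq> \<zero>"
    using idem d unfolding nonzero_idempotent_multiples_def by blast
  define e where "e = d \<otimes> y"
  \<comment> \<open>This splits \<open>e\<close> as \<open>a \<otimes> c\<close>, so
    \<open>c\<close> acts as a right inverse of \<open>a\<close> in the corner of
    \<open>e\<close>.\<close>
  define c where "c = (a \<ominus> \<one>) \<otimes> y"
  have carr: "a \<in> carrier R" "c \<in> carrier R" "e \<in> carrier R"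
    using a y d by (auto simp: c_def e_def)
  have ac: "a \<otimes> c = e" using a y by (simp add: c_def e_def d_def m_assoc)
  have e: "e \<in> idempotents R" using y by (simp add: e_def)
  then have ee: "e \<otimes> e = e" by (simp add: idempotents_def)
  have ae: "a \<otimes> e = e \<otimes> a" "c \<otimes> e = e \<otimes> c" using central e carr by auto
  have tails: "e \<otimes> (e \<otimes> z) = e \<otimes> z" "a \<otimes> (e \<otimes> z) = e \<otimes> (a \<otimes> z)" if "z \<in> carrier R" for z
    using that carr ee ae by (simp_all flip: m_assoc)
  \<comment> \<open>Glue \<open>a\<close> and \<open>c\<close> on the corner of \<open>e\<close>
    with the identity on the complementary corner.\<close>
  define v w where "v = e \<otimes> a \<oplus> (\<one> \<ominus> e)" and "w = e \<otimes> c \<oplus> (\<one> \<ominus> e)"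
  have vw: "v \<in> carrier R" "w \<in> carrier R" using carr by (auto simp: v_def w_def)
  have vw1: "v \<otimes> w = \<one>"
    using carr by (simp add: v_def w_def minus_eq l_distr r_distr l_minus r_minus m_assoc
        ee ae ac tails r_neg l_neg a_ac minus_add r_neg1 r_neg2)
  \<comment> \<open>A one-sided inverse is two-sided here: \<open>w \<otimes> v\<close> is
    idempotent, hence central, and can be moved past \<open>v\<close>.\<close>
  then have "(w \<otimes> v) \<otimes> (w \<otimes> v) = w \<otimes> v" using vw by (metis m_assoc r_one m_closed)
  then have wv: "w \<otimes> v \<in> idempotents R" using vw by (simp add: idempotents_def)
  have "w \<otimes> v = (w \<otimes> v) \<otimes> (v \<otimes> w)" using vw vw1 by simp
  also have "\<dots> = v \<otimes> (w \<otimes> v) \<otimes> w"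
    using central[OF wv vw(1)] vw by (simp add: m_assoc)
  also have "\<dots> = (v \<otimes> w) \<otimes> (v \<otimes> w)" using vw by (simp add: m_assoc)
  finally have "w \<otimes> v = \<one>" using vw1 by simp
  then have "v \<in> Units R" using vw vw1 by (auto simp: Units_def)
  then obtain n :: nat where "(v \<ominus> \<one>) [^] n = \<zero>" using uni by (auto simp: unipotent_units_def)
  then have "v \<ominus> \<one> = \<zero>" using reduced_nilpotent_zero[of "v \<ominus> \<one>" n] red vw by blast
  moreover have "v \<ominus> \<one> = e \<otimes> a \<ominus> e \<oplus> (\<one> \<ominus> \<one>)"
    using carr by (simp add: v_def minus_eq a_ac)
  ultimately have ea: "e \<otimes> a = e" using carr by (simp add: minus_eq r_neg)
      (metis m_closed minus_eq r_right_minus_eq)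
  \<comment> \<open>The factor \<open>a \<ominus> \<one>\<close> of \<open>d\<close> is killed by
    \<open>e\<close>, because \<open>e \<otimes> a = e\<close>.\<close>
  have "e = e \<otimes> (d \<otimes> y)" using ee by (simp add: e_def)
  also have "\<dots> = e \<otimes> a \<otimes> (a \<ominus> \<one>) \<otimes> y" using carr y by (simp add: d_def m_assoc)
  also have "\<dots> = \<zero>" using carr y by (simp add: ea minus_eq r_distr r_minus r_neg)
  finally show False using y(3) by (simp add: e_def)
qed

section \<open>Units, \<open>J_sharp\<close> and exchange idempotents\<close>

lemma jacobson_radical_cong_one_Units:
  assumes "u \<in> carrier R" "\<one> \<ominus> u \<in> jacobson_radical R"
  shows "u \<in> Units R"
proof -
  have "\<one> \<ominus> (\<one> \<ominus> u) = u"
    using assms(1) by (simp add: minus_eq minus_add r_neg2)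
  then show ?thesis using jacobson_radical_one_minus_Units[OF assms(2)] by simp
qed

lemma Units_if_left_right_inverse:
  assumes "u \<in> carrier R" "v \<in> carrier R" "w \<in> carrier R" "u \<otimes> v \<in> Units R" "w \<otimes> u \<in> Units R"
  shows "u \<in> Units R"
proof -
  have "u \<otimes> (v \<otimes> inv (u \<otimes> v)) = \<one>" "(inv (w \<otimes> u) \<otimes> w) \<otimes> u = \<one>"
    using assms by (simp_all flip: m_assoc) (simp_all add: m_assoc)
  then show ?thesis
    using Units_of_left_inverses(1)[of u "v \<otimes> inv (u \<otimes> v)" "inv (w \<otimes> u) \<otimes> w"] assms by auto
qed

text \<open>The cofactor is the geometric sum, extended by
  \<open>\<one> \<oplus> g \<otimes> w\<close>. Having it on both sides yields inverses on both
  sides once the left-hand side is a unit.\<close>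

lemma one_minus_dvd_one_minus_pow:
  assumes w: "w \<in> carrier R"
  shows "\<exists>g\<in>carrier R. \<one> \<ominus> w [^] (n::nat) = (\<one> \<ominus> w) \<otimes> g \<and> \<one> \<ominus> w [^] n = g \<otimes> (\<one> \<ominus> w)"
proof (induction n)
  case 0
  then show ?case using w by (intro bexI[of _ \<zero>]) (auto simp: minus_eq r_neg)
next
  case (Suc n)
  then obtain g where g: "g \<in> carrier R" "\<one> \<ominus> w [^] n = (\<one> \<ominus> w) \<otimes> g"
    "\<one> \<ominus> w [^] n = g \<otimes> (\<one> \<ominus> w)" by blast
  have 1: "\<one> \<ominus> w [^] Suc n = (\<one> \<ominus> w) \<oplus> (\<one> \<ominus> w [^] n) \<otimes> w"
    using w by (simp add: minus_eq l_distr l_minus a_assoc r_neg2 r_neg1)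
  have "(\<one> \<ominus> w) \<oplus> (\<one> \<ominus> w [^] n) \<otimes> w = (\<one> \<ominus> w) \<otimes> (\<one> \<oplus> g \<otimes> w)"
    unfolding g(2) using w g(1) by (simp add: r_distr m_assoc)
  moreover have "(\<one> \<ominus> w) \<oplus> (\<one> \<ominus> w [^] n) \<otimes> w = (\<one> \<oplus> g \<otimes> w) \<otimes> (\<one> \<ominus> w)"
    unfolding g(3) using w g(1) by (simp add: l_distr m_assoc minus_eq r_distr l_minus r_minus minus_add a_ac)
  ultimately show ?case using 1 w g(1) by (intro bexI[of _ "\<one> \<oplus> g \<otimes> w"]) auto
qed

text \<open>The parity of \<open>n\<close> can stay implicit, since the radical is closed under
  negation.\<close>

lemma minus_pow_cases:
  assumes "z \<in> carrier R"
  shows "(\<ominus> z) [^] (n::nat) = z [^] n \<or> (\<ominus> z) [^] n = \<ominus> (z [^] n)"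
  by (induction n) (use assms in \<open>auto simp: l_minus r_minus\<close>)

text \<open>With \<open>w = \<ominus> z\<close>, the element \<open>\<one> \<oplus> z\<close>
  divides the unit \<open>\<one> \<ominus> w [^] n\<close> from both sides.\<close>

lemma one_plus_J_sharp_Units:
  assumes "z \<in> J_sharp R"
  shows "\<one> \<oplus> z \<in> Units R"
proof -
  obtain n :: nat where z: "z \<in> carrier R" "z [^] n \<in> jacobson_radical R"
    using assms by (auto simp: J_sharp_def)
  then have "(\<ominus> z) [^] n \<in> jacobson_radical R"
    using minus_pow_cases[of z n] left_idealD(5)[OF left_ideal_jacobson_radical] by metis
  then have u: "\<one> \<ominus> (\<ominus> z) [^] n \<in> Units R" by (rule jacobson_radical_one_minus_Units)
  have "\<one> \<ominus> (\<ominus> z) = \<one> \<oplus> z" using z by (simp add: minus_eq)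
  then obtain g where "g \<in> carrier R" "(\<one> \<oplus> z) \<otimes> g \<in> Units R" "g \<otimes> (\<one> \<oplus> z) \<in> Units R"
    using one_minus_dvd_one_minus_pow[of "\<ominus> z" n] z u by auto
  then show ?thesis using Units_if_left_right_inverse[of "\<one> \<oplus> z"] z by blast
qed

text \<open>Multiplication by \<open>a\<close> fixes \<open>e\<close> and kills
  \<open>\<one> \<ominus> e\<close>. Applied in the quotient, this shows that the exchange
  idempotent of a representative is a lift.\<close>

lemma exchange_witness_eq:
  assumes "a \<in> idempotents R" "x \<in> carrier R" "y \<in> carrier R" "e = a \<otimes> x"
    and "\<one> \<ominus> e = (\<one> \<ominus> a) \<otimes> y"
  shows "a = e"
proof -
  have a: "a \<in> carrier R" "a \<otimes> a = a" using assms by (auto simp: idempotents_def)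
  have e: "e \<in> carrier R" "a \<otimes> e = e" using assms(2,4) a by (simp_all flip: m_assoc)
  have "a \<otimes> (\<one> \<ominus> e) = (a \<ominus> a \<otimes> a) \<otimes> y"
    unfolding assms(5) using a(1) assms(3) by (simp add: minus_eq l_distr r_distr l_minus r_minus m_assoc)
  then have "a \<ominus> a \<otimes> e = \<zero>" using a e(1) assms(3) by (simp add: minus_eq r_distr r_minus r_neg)
  then show ?thesis using a(1) e by simp
qed

section \<open>The quotient by the Jacobson radical\<close>

abbreviation J where "J \<equiv> jacobson_radical R"
abbreviation S where "S \<equiv> R Quot jacobson_radical R"

lemma Quot_carrier: "carrier S = (\<lambda>a. J +> a) ` carrier R"
  by (auto simp: FactRing_simps)

lemma Quot_zero_iff:
  assumes "a \<in> carrier R"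
  shows "J +> a = \<zero>\<^bsub>S\<^esub> \<longleftrightarrow> a \<in> J"
  using ideal.rcos_const_imp_mem[OF ideal_jacobson_radical assms]
    a_rcos_zero[OF ideal_jacobson_radical] by (auto simp: FactRing_def)

lemma Quot_hom: "ring_hom_ring R S ((+>) J)"
  by (rule ideal.rcos_ring_hom_ring[OF ideal_jacobson_radical])

lemma Quot_eq_iff:
  assumes "a \<in> carrier R" "b \<in> carrier R"
  shows "J +> a = J +> b \<longleftrightarrow> a \<ominus> b \<in> J"
  using quotient_eq_iff_same_a_r_cos[OF ideal_jacobson_radical assms] by simp

text \<open>Units lift: if \<open>a \<otimes> b\<close> and \<open>b \<otimes> a\<close> are
  congruent to \<open>\<one>\<close>, both are units, hence so is \<open>a\<close>. Then
  \<open>a \<ominus> \<one>\<close> has a power in the radical.\<close>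

lemma unipotent_units_Quot:
  assumes "UJ_sharp_ring R"
  shows "unipotent_units S"
  unfolding unipotent_units_def
proof
  interpret h: ring_hom_ring R S "(+>) J" by (rule Quot_hom)
  fix u assume "u \<in> Units S"
  then obtain a b where ab: "a \<in> carrier R" "b \<in> carrier R" "u = J +> a"
    and inv: "(J +> a) \<otimes>\<^bsub>S\<^esub> (J +> b) = \<one>\<^bsub>S\<^esub>" "(J +> b) \<otimes>\<^bsub>S\<^esub> (J +> a) = \<one>\<^bsub>S\<^esub>"
    by (auto simp: Units_def Quot_carrier)
  have "J +> \<one> = J +> a \<otimes> b" "J +> \<one> = J +> b \<otimes> a"
    using ab inv by simp_all
  then have "\<one> \<ominus> a \<otimes> b \<in> J" "\<one> \<ominus> b \<otimes> a \<in> J"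
    using ab Quot_eq_iff[of \<one>] by (metis m_closed one_closed)+
  then have "a \<in> Units R"
    using ab Units_if_left_right_inverse[of a b b]
      jacobson_radical_cong_one_Units[of "a \<otimes> b"] jacobson_radical_cong_one_Units[of "b \<otimes> a"]
    by simp
  then obtain z where z: "z \<in> J_sharp R" "a = \<one> \<oplus> z"
    using assms by (auto simp: UJ_sharp_ring_def)
  then obtain n :: nat where n: "z \<in> carrier R" "z [^] n \<in> J" by (auto simp: J_sharp_def)
  have "a \<ominus> \<one> = z \<oplus> (\<one> \<ominus> \<one>)"
    using z(2) n(1) by (simp add: minus_eq a_ac)
  then have "a \<ominus> \<one> = z" using n(1) by (simp add: minus_eq r_neg)
  moreover have "J +> (a \<ominus> \<one>) = u \<ominus>\<^bsub>S\<^esub> \<one>\<^bsub>S\<^esub>"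
    using ab by (simp add: minus_eq h.S.minus_eq)
  ultimately have "(u \<ominus>\<^bsub>S\<^esub> \<one>\<^bsub>S\<^esub>) [^]\<^bsub>S\<^esub> n = J +> (z [^] n)"
    using n(1) h.hom_nat_pow[of z n] by simp
  then show "\<exists>n::nat. (u \<ominus>\<^bsub>S\<^esub> \<one>\<^bsub>S\<^esub>) [^]\<^bsub>S\<^esub> n = \<zero>\<^bsub>S\<^esub>"
    using n Quot_zero_iff[of "z [^] n"] by auto
qed

lemma nonzero_idempotent_multiples_if_regular:
  assumes "von_neumann_regular_ring R"
  shows "nonzero_idempotent_multiples R"
  unfolding nonzero_idempotent_multiples_def
proof
  fix x assume x: "x \<in> carrier R - {\<zero>}"
  then obtain y where y: "y \<in> carrier R" "x \<otimes> y \<otimes> x = x"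
    using assms unfolding von_neumann_regular_ring_def by (metis DiffD1)
  have "x \<otimes> y \<otimes> (x \<otimes> y) = x \<otimes> y \<otimes> x \<otimes> y" using x y(1) by (simp add: m_assoc)
  then have "x \<otimes> y \<otimes> (x \<otimes> y) = x \<otimes> y" by (simp only: y(2))
  moreover have "x \<otimes> y \<noteq> \<zero>"
  proof
    assume "x \<otimes> y = \<zero>"
    then show False using x y(2) by simp
  qed
  ultimately show "\<exists>y\<in>carrier R. x \<otimes> y \<in> idempotents R - {\<zero>}"
    using x y(1) by (auto simp: idempotents_def intro!: bexI[of _ y])
qed

lemma exchange_ringE:
  assumes "exchange_ring R" "a \<in> carrier R"
  obtains e x y where "e \<in> idempotents R" "x \<in> carrier R" "y \<in> carrier R"
    "e = a \<otimes> x" "\<one> \<ominus> e = (\<one> \<ominus> a) \<otimes> y"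
  using assms unfolding exchange_ring_def l_coset_def by blast

text \<open>For \<open>c\<close> outside the radical some
  \<open>\<one> \<ominus> c \<otimes> r\<close> has no right inverse. The exchange idempotent
  \<open>e\<close> of \<open>c \<otimes> r\<close> is not radical: otherwise
  \<open>\<one> \<ominus> e\<close> would be a unit and a right multiple of
  \<open>\<one> \<ominus> c \<otimes> r\<close>.\<close>

lemma nonzero_idempotent_multiples_Quot:
  assumes exch: "exchange_ring R"
  shows "nonzero_idempotent_multiples S"
  unfolding nonzero_idempotent_multiples_def
proof
  interpret h: ring_hom_ring R S "(+>) J" by (rule Quot_hom)
  fix x assume "x \<in> carrier S - {\<zero>\<^bsub>S\<^esub>}"
  then obtain c where c: "c \<in> carrier R" "x = J +> c" "c \<notin> J"
    using Quot_zero_iff by (auto simp: Quot_carrier)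
  then obtain r where r: "r \<in> carrier R" "\<And>v. v \<in> carrier R \<Longrightarrow> (\<one> \<ominus> c \<otimes> r) \<otimes> v \<noteq> \<one>"
    using jacobson_radicalI_right_inverse[of c] by blast
  obtain e t s where e: "e \<in> idempotents R" "t \<in> carrier R" "s \<in> carrier R" "e = c \<otimes> r \<otimes> t"
    "\<one> \<ominus> e = (\<one> \<ominus> c \<otimes> r) \<otimes> s"
    using exchange_ringE[OF exch, of "c \<otimes> r"] c r(1) by blast
  have ec: "e \<in> carrier R" "e \<otimes> e = e" using e(1) by (auto simp: idempotents_def)
  have "e \<notin> J"
  proof
    assume "e \<in> J"
    then have u: "\<one> \<ominus> e \<in> Units R" by (rule jacobson_radical_one_minus_Units)
    then have "(\<one> \<ominus> c \<otimes> r) \<otimes> (s \<otimes> inv (\<one> \<ominus> e)) = (\<one> \<ominus> e) \<otimes> inv (\<one> \<ominus> e)"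
      using c r(1) e(3) ec(1) by (simp add: Units_inv_closed Units_r_inv flip: e(5) m_assoc)
    then show False using u r(2)[of "s \<otimes> inv (\<one> \<ominus> e)"] e(3)
      by (simp add: Units_inv_closed Units_r_inv)
  qed
  have xy: "x \<otimes>\<^bsub>S\<^esub> (J +> (r \<otimes> t)) = J +> e"
    using c r(1) e(2) h.hom_mult[of c "r \<otimes> t"] by (simp add: e(4) m_assoc)
  have "(J +> e) \<otimes>\<^bsub>S\<^esub> (J +> e) = J +> e"
    using ec h.hom_mult[of e e] by simp
  then have "J +> e \<in> idempotents S - {\<zero>\<^bsub>S\<^esub>}"
    using \<open>e \<notin> J\<close> ec Quot_zero_iff[of e] by (auto simp: idempotents_def Quot_carrier)
  then show "\<exists>y\<in>carrier S. x \<otimes>\<^bsub>S\<^esub> y \<in> idempotents S - {\<zero>\<^bsub>S\<^esub>}"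
    using r(1) e(2) xy h.hom_closed[of "r \<otimes> t"] by (metis m_closed)
qed

lemma exchange_idempotents_lift:
  assumes exch: "exchange_ring R"
  shows "idempotents_lift R J"
  unfolding idempotents_lift_def
proof
  interpret h: ring_hom_ring R S "(+>) J" by (rule Quot_hom)
  fix x assume x: "x \<in> idempotents S"
  then obtain a where a: "a \<in> carrier R" "x = J +> a"
    by (auto simp: idempotents_def Quot_carrier)
  obtain e t s where e: "e \<in> idempotents R" "t \<in> carrier R" "s \<in> carrier R" "e = a \<otimes> t"
    "\<one> \<ominus> e = (\<one> \<ominus> a) \<otimes> s"
    using exchange_ringE[OF exch a(1)] by blast
  have ec: "e \<in> carrier R" using e(1) by (simp add: idempotents_def)
  have "x = J +> e"
  proof (rule h.S.exchange_witness_eq[OF x])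
    show "J +> t \<in> carrier S" "J +> s \<in> carrier S" using e by simp_all
    show "J +> e = x \<otimes>\<^bsub>S\<^esub> (J +> t)" using a e by simp
    have "J +> (\<one> \<ominus> e) = J +> ((\<one> \<ominus> a) \<otimes> s)" by (simp only: e(5))
    then show "\<one>\<^bsub>S\<^esub> \<ominus>\<^bsub>S\<^esub> (J +> e) = (\<one>\<^bsub>S\<^esub> \<ominus>\<^bsub>S\<^esub> x) \<otimes>\<^bsub>S\<^esub> (J +> s)"
      using a e(3) ec by (simp add: minus_eq h.S.minus_eq)
  qed
  then show "\<exists>e\<in>idempotents R. J +> e = x" using e(1) by blast
qed

section \<open>Consequences of the semi-Boolean condition\<close>

text \<open>A unit is idempotent modulo the radical, and cancelling it puts
  \<open>u \<ominus> \<one>\<close> in the radical, so the exponent \<open>1\<close>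
  suffices.\<close>

lemma semi_boolean_UJ_sharp_ring:
  assumes "semi_boolean_ring R"
  shows "UJ_sharp_ring R"
  unfolding UJ_sharp_ring_def
proof
  interpret h: ring_hom_ring R S "(+>) J" by (rule Quot_hom)
  show "(\<lambda>z. \<one> \<oplus> z) ` J_sharp R \<subseteq> Units R" using one_plus_J_sharp_Units by blast
  show "Units R \<subseteq> (\<lambda>z. \<one> \<oplus> z) ` J_sharp R"
  proof
    fix u assume u: "u \<in> Units R"
    then have uc: "u \<in> carrier R" by (rule Units_closed)
    have "(J +> u) \<otimes>\<^bsub>S\<^esub> (J +> u) = J +> u"
      using assms uc by (auto simp: semi_boolean_ring_def boolean_ring_def idempotents_def)
    then have "u \<otimes> u \<ominus> u \<in> J" using uc Quot_eq_iff[of "u \<otimes> u" u] by simp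
    then have "inv u \<otimes> (u \<otimes> u \<ominus> u) \<in> J"
      using u left_idealD(4)[OF left_ideal_jacobson_radical] by simp
    moreover have "inv u \<otimes> (u \<otimes> u \<ominus> u) = u \<ominus> \<one>"
      using u uc by (simp add: minus_eq r_distr r_minus flip: m_assoc)
    ultimately have "u \<ominus> \<one> \<in> J_sharp R"
      using uc by (auto simp: J_sharp_def intro!: exI[of _ "1::nat"])
    moreover have "u = \<one> \<oplus> (u \<ominus> \<one>)" using uc by (simp add: minus_eq a_ac r_neg2 r_neg1 r_neg)
    ultimately show "u \<in> (\<lambda>z. \<one> \<oplus> z) ` J_sharp R" by blast
  qed
qed

lemma mult_mem_l_coset_carrier:
  assumes "b = a \<otimes> x" "x \<in> carrier R"
  shows "b \<in> a <# carrier R"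
  using assms by (auto simp: l_coset_def)

lemma semi_boolean_exchange_ring:
  assumes sb: "semi_boolean_ring R"
  shows "exchange_ring R"
  unfolding exchange_ring_def
proof
  interpret h: ring_hom_ring R S "(+>) J" by (rule Quot_hom)
  fix a assume a: "a \<in> carrier R"
  have aS: "J +> a \<in> idempotents S"
    using sb a by (simp add: semi_boolean_ring_def boolean_ring_def)
  then obtain e where e: "e \<in> idempotents R" "J +> e = J +> a"
    using sb by (auto simp: semi_boolean_ring_def idempotents_lift_def)
  then have ec: "e \<in> carrier R" and ee: "e \<otimes> e = e" by (auto simp: idempotents_def)
  \<comment> \<open>As \<open>e\<close> is congruent to \<open>a\<close>, this is a unit, and
    \<open>u \<otimes> e = a \<otimes> e\<close>. Conjugating \<open>e\<close> by \<open>u\<close>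
    therefore gives an idempotent \<open>f\<close> that is a right multiple of
    \<open>a\<close>.\<close>
  define u where "u = \<one> \<ominus> (e \<ominus> a)"
  have uc: "u \<in> carrier R" using a ec by (simp add: u_def)
  have u: "u \<in> Units R"
    unfolding u_def using e(2) a ec Quot_eq_iff by (intro jacobson_radical_one_minus_Units) blast
  have "u \<otimes> e = e \<oplus> (a \<otimes> e \<oplus> \<ominus> e)"
    using a ec ee by (simp add: u_def minus_eq l_distr l_minus minus_add a_ac)
  then have ue: "u \<otimes> e = a \<otimes> e" using a ec by (simp add: a_ac r_neg1 r_neg2 r_neg)
  define f where "f = a \<otimes> e \<otimes> inv u"
  have fc: "f \<in> carrier R" using a ec u by (simp add: f_def)
  have f: "f = u \<otimes> e \<otimes> inv u" by (simp add: f_def ue)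
  have "f \<otimes> f = u \<otimes> (e \<otimes> ((inv u \<otimes> u) \<otimes> (e \<otimes> inv u)))"
    using u uc ec by (simp only: f m_assoc m_closed Units_inv_closed)
  also have "\<dots> = u \<otimes> ((e \<otimes> e) \<otimes> inv u)" using u uc ec by (simp add: m_assoc)
  finally have ff: "f \<otimes> f = f" using u uc ec by (simp add: ee f m_assoc)
  \<comment> \<open>Modulo the radical \<open>u\<close> is one and \<open>e\<close> is
    \<open>a\<close>, so \<open>f\<close> becomes \<open>a \<otimes> a\<close>, that is,
    \<open>a\<close>.\<close>
  have hu: "J +> u = \<one>\<^bsub>S\<^esub>"
    using a ec e(2) by (simp add: u_def minus_eq h.S.minus_eq h.S.r_neg)
  have "J +> (u \<otimes> inv u) = (J +> u) \<otimes>\<^bsub>S\<^esub> (J +> inv u)"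
    by (rule h.hom_mult) (use u in \<open>simp_all add: Units_closed Units_inv_closed\<close>)
  then have "J +> inv u = \<one>\<^bsub>S\<^esub>" using u by (simp add: hu)
  then have "J +> f = J +> a"
    using a ec u e(2) aS by (simp add: f_def idempotents_def)
  then have "a \<ominus> f \<in> J" using a fc Quot_eq_iff[of a f] by simp
  \<comment> \<open>Since \<open>f \<equiv> a\<close> modulo \<open>J\<close>, the element \<open>f + (1 - a)\<close> is a unit; this corrects \<open>f\<close> to an
    idempotent \<open>g \<in> fR\<close> with \<open>1 - g \<in> (1 - a)R\<close>.\<close>
  define w where "w = \<one> \<ominus> (a \<ominus> f)"
  have w: "w \<in> Units R"
    unfolding w_def using \<open>a \<ominus> f \<in> J\<close> by (rule jacobson_radical_one_minus_Units)
  define s where "s = inv w"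
  have sc: "s \<in> carrier R" using w by (simp add: s_def)
  have "w = f \<oplus> (\<one> \<ominus> a)" using a fc by (simp add: w_def minus_eq minus_add a_ac)
  then have "(f \<oplus> (\<one> \<ominus> a)) \<otimes> s = \<one>" using w by (simp add: s_def)
  then have "(\<one> \<ominus> a) \<otimes> s \<oplus> f \<otimes> s = \<one>" using a fc sc by (simp add: l_distr a_comm)
  then have as: "(\<one> \<ominus> a) \<otimes> s = \<one> \<ominus> f \<otimes> s"
    using a fc sc by (metis add.inv_solve_right m_closed minus_closed minus_eq one_closed)
  have ff': "f \<otimes> (f \<otimes> z) = f \<otimes> z" if "z \<in> carrier R" for z
    using that fc ff by (simp flip: m_assoc)
  \<comment> \<open>Chosen so that \<open>\<one> \<ominus> g = (\<one> \<ominus> f \<otimes> s)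
    \<otimes> (\<one> \<ominus> f)\<close>, where \<open>as\<close> makes the first factor a
    multiple of \<open>\<one> \<ominus> a\<close>. It is idempotent since
    \<open>(\<one> \<ominus> f) \<otimes> f = \<zero>\<close>.\<close>
  define g where "g = f \<oplus> f \<otimes> s \<otimes> (\<one> \<ominus> f)"
  have gc: "g \<in> carrier R" using fc sc by (simp add: g_def)
  have "g \<otimes> g = g"
    using fc sc by (simp add: g_def minus_eq l_distr r_distr l_minus r_minus m_assoc ff ff'
        a_ac minus_add r_neg r_neg1 r_neg2)
  then have "g \<in> idempotents R" using gc by (simp add: idempotents_def)
  moreover have "g = a \<otimes> (e \<otimes> inv u \<otimes> (\<one> \<oplus> s \<otimes> (\<one> \<ominus> f)))"
  proof -
    have "g = f \<otimes> (\<one> \<oplus> s \<otimes> (\<one> \<ominus> f))" using fc sc by (simp add: g_def r_distr m_assoc)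
    then show ?thesis using a ec u fc sc by (simp add: f_def[symmetric] flip: m_assoc)
  qed
  then have "g \<in> a <# carrier R"
    by (rule mult_mem_l_coset_carrier) (use ec u fc sc in simp)
  moreover have "\<one> \<ominus> g = (\<one> \<ominus> a) \<otimes> (s \<otimes> (\<one> \<ominus> f))"
  proof -
    have "(\<one> \<ominus> a) \<otimes> (s \<otimes> (\<one> \<ominus> f)) = (\<one> \<ominus> f \<otimes> s) \<otimes> (\<one> \<ominus> f)"
      using a fc sc by (simp add: m_assoc flip: as)
    then show ?thesis
      using fc sc by (simp add: g_def minus_eq l_distr r_distr l_minus r_minus m_assoc minus_add a_ac)
  qed
  then have "\<one> \<ominus> g \<in> (\<one> \<ominus> a) <# carrier R"
    by (rule mult_mem_l_coset_carrier) (use fc sc in simp)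
  ultimately show "\<exists>e\<in>idempotents R. e \<in> a <# carrier R \<and> \<one> \<ominus> e \<in> (\<one> \<ominus> a) <# carrier R"
    by blast
qed

lemma boolean_von_neumann_regular_ring:
  assumes "boolean_ring R"
  shows "von_neumann_regular_ring R"
  unfolding von_neumann_regular_ring_def
proof
  fix a assume a: "a \<in> carrier R"
  then have "a \<otimes> a = a" using assms by (auto simp: boolean_ring_def idempotents_def)
  then have "a = a \<otimes> a \<otimes> a" by simp
  then show "\<exists>x\<in>carrier R. a = a \<otimes> x \<otimes> a" using a by blast
qed

end

theorem theorem3p4:
  fixes R :: "('a, 'b) ring_scheme"
  assumes "ring R"
  shows "(semi_regular_ring R \<and> UJ_sharp_ring R \<longleftrightarrow> exchange_ring R \<and> UJ_sharp_ring R)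
       \<and> (exchange_ring R \<and> UJ_sharp_ring R \<longleftrightarrow> semi_boolean_ring R)"
proof -
  interpret ring R by fact
  interpret S: ring "R Quot jacobson_radical R"
    by (rule ideal.quotient_is_ring[OF ideal_jacobson_radical])
  \<comment> \<open>All implications pass through \<open>semi_boolean_ring R\<close>.\<close>
  have "semi_boolean_ring R" if "semi_regular_ring R" "UJ_sharp_ring R"
    using that S.boolean_ring_if_unipotent_units[OF unipotent_units_Quot]
      S.nonzero_idempotent_multiples_if_regular
    by (auto simp: semi_regular_ring_def semi_boolean_ring_def)
  moreover have "semi_boolean_ring R" if "exchange_ring R" "UJ_sharp_ring R"
    using that S.boolean_ring_if_unipotent_units[OF unipotent_units_Quot]
      nonzero_idempotent_multiples_Quot exchange_idempotents_lift
    by (auto simp: semi_boolean_ring_def)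
  moreover have "semi_regular_ring R" if "semi_boolean_ring R"
    using that S.boolean_von_neumann_regular_ring
    by (simp add: semi_regular_ring_def semi_boolean_ring_def)
  ultimately show ?thesis
    using semi_boolean_UJ_sharp_ring semi_boolean_exchange_ring by blast
qed

end
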